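(* Fix positive integers $m > k$ and $n$. Then the following are equivalent: (i) $\mathrm{Tr}[S_{m,k}(A,B)] \geq 0$ for all $n \times n$ positive semidefinite matrices $A$ and $B$; (ii) for all $n\times n$ positive semidefinite matrices $A$ and $B$ with $S_{m,k}(A,B) \neq 0$, the matrix $S_{m,k}(A,B)$ has at least one positive eigenvalue.
   Context: Matrices are complex. A positive semidefinite matrix is a complex Hermitian matrix all of whose eigenvalues are nonnegative. For $n\times n$ matrices $A,B$ and integers $m\ge 0$, $0\le k\le m$, $S_{m,k}(A,B)$ denotes the sum of all words of length $m$ in $A$ and $B$ in which exactly $k$ $B$'s appear, i.e. the (matrix) coefficient of $t^k$ in $(A+tB)^m$ (so $S_{0,0}(A,B)=I$). When $A,B$ are Hermitian, $S_{m,k}(A,B)$ is Hermitian, so it has real eigenvalues and real trace. *)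

theory Defs
  imports "HOL-Analysis.Analysis" "HOL-Library.Complex_Order"
begin

definition adjoint_matrix :: "complex^'n^'m \<Rightarrow> complex^'m^'n" where
  "adjoint_matrix M = (\<chi> i j. cnj (M $ j $ i))"

definition hermitian :: "complex^'n^'n \<Rightarrow> bool" where
  "hermitian M \<longleftrightarrow> adjoint_matrix M = M"

definition eigenvalue :: "complex^'n^'n \<Rightarrow> complex \<Rightarrow> bool" where
  "eigenvalue M c \<longleftrightarrow> (\<exists>v. v \<noteq> 0 \<and> M *v v = c *s v)"

(* The order on complex numbers is that of HOL-Library.Complex_Order: 0 \<le> c means
   that c is real and nonnegative, and 0 < c that c is real and positive. *)

definition psd :: "complex^'n^'n \<Rightarrow> bool" where
  "psd M \<longleftrightarrow> hermitian M \<and> (\<forall>c. eigenvalue M c \<longrightarrow> 0 \<le> c)"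

(* A word is a list of booleans, with True standing for the letter B and False for A.
   Its value is a product with **, since * on vectors is componentwise. *)

primrec word_prod :: "complex^'n^'n \<Rightarrow> complex^'n^'n \<Rightarrow> bool list \<Rightarrow> complex^'n^'n" where
  "word_prod A B [] = mat 1"
| "word_prod A B (b # w) = (if b then B else A) ** word_prod A B w"

definition word_sum :: "nat \<Rightarrow> nat \<Rightarrow> complex^'n^'n \<Rightarrow> complex^'n^'n \<Rightarrow> complex^'n^'n" where
  "word_sum m k A B = (\<Sum>w\<in>{w. length w = m \<and> count_list w True = k}. word_prod A B w)"

lemma finite_words: "finite {w :: bool list. length w = m \<and> count_list w True = k}"
  by (rule finite_subset[OF _ finite_lists_length_eq[of "UNIV :: bool set" m]]) auto

end

theory Submission
  imports Defs
begin

text \<open>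
  Write \<open>S\<^sub>m\<^sub>,\<^sub>k\<close> for \<open>word_sum m k A B\<close>. One direction is soft: a nonzero Hermitian matrix without
  positive eigenvalues is negative semidefinite, and a negative semidefinite matrix of
  nonnegative trace vanishes (\<open>psd_trace_le_0_imp_0\<close>).

  For the converse, the trace of \<open>S\<^sub>m\<^sub>,\<^sub>k\<close> is minimised over pairs of positive semidefinite matrices
  of trace 1. A minimiser \<open>(A, B)\<close> exists by compactness and homogeneity
  (\<open>trace_word_sum_minimizer\<close>). Let \<open>c\<close> be the minimum. Since the trace of a product is cyclic, the
  derivative of \<open>Tr S\<^sub>m\<^sub>,\<^sub>k\<close> along a curve through \<open>A\<close> with velocity \<open>H\<close> is
  \<open>m Tr (S\<^sub>m\<^sub>-\<^sub>1\<^sub>,\<^sub>k H)\<close> (\<open>has_vector_derivative_trace_word_sum\<close>). Curves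
  \<open>(1 + t X)\<^sup>* A (1 + t X)\<close> stay positive semidefinite, and stationarity along them gives
  \<open>m A S\<^sub>m\<^sub>-\<^sub>1\<^sub>,\<^sub>k = c (m - k) A\<close> (\<open>first_order_condition\<close>). Exchanging the letters gives
  \<open>m B S\<^sub>m\<^sub>-\<^sub>1\<^sub>,\<^sub>k\<^sub>-\<^sub>1 = c k B\<close>. Sorting words by their first letter, the sum of the two equations is
    \<open>m S\<^sub>m\<^sub>,\<^sub>k = c ((m - k) A + k B)\<close>.
  If \<open>c < 0\<close>, this matrix is nonzero and negative semidefinite, so it has no positive
  eigenvalue. Hence the eigenvalue condition forces \<open>c \<ge> 0\<close>, and by homogeneity all the traces
  are nonnegative.

  Positive semidefiniteness is used throughout as nonnegativity of the quadratic form
  (\<open>psd_iff_quadratic_form\<close>). The inner product \<open>\<bullet>\<close> is the real one, that is, the real part of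
  the Hermitian inner product; for a Hermitian matrix it carries the same information and it
  connects directly to real derivatives and compactness.
\<close>

section \<open>Matrix operations, adjoint and trace\<close>

lemma bounded_bilinear_matrix_mul: "bounded_bilinear ((**) :: complex^'n^'m \<Rightarrow> complex^'p^'n \<Rightarrow> complex^'p^'m)"
  unfolding bilinear_conv_bounded_bilinear [symmetric] bilinear_def
  by (auto intro!: linearI simp: matrix_matrix_mult_def vec_eq_iff scaleR_sum_right
      sum.distrib algebra_simps)

interpretation matmul: bounded_bilinear "(**) :: complex^'n^'m \<Rightarrow> complex^'p^'n \<Rightarrow> complex^'p^'m"
  by (rule bounded_bilinear_matrix_mul)

lemma bounded_bilinear_matrix_vector_mul:
  "bounded_bilinear ((*v) :: complex^'n^'m \<Rightarrow> complex^'n \<Rightarrow> complex^'m)"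
  unfolding bilinear_conv_bounded_bilinear [symmetric] bilinear_def
  by (auto intro!: linearI simp: matrix_vector_mult_def vec_eq_iff scaleR_sum_right
      sum.distrib algebra_simps)

interpretation matvec: bounded_bilinear "(*v) :: complex^'n^'m \<Rightarrow> complex^'n \<Rightarrow> complex^'m"
  by (rule bounded_bilinear_matrix_vector_mul)

lemma linear_trace: "linear (trace :: complex^'n^'n \<Rightarrow> complex)"
  by (auto intro!: linearI simp: trace_def scaleR_sum_right sum.distrib)

lemma linear_adjoint_matrix: "linear (adjoint_matrix :: complex^'n^'n \<Rightarrow> complex^'n^'n)"
  by (auto intro!: linearI simp: adjoint_matrix_def vec_eq_iff)

lemma adjoint_adjoint [simp]: "adjoint_matrix (adjoint_matrix M) = M"
  by (simp add: adjoint_matrix_def vec_eq_iff)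

lemma adjoint_one [simp]: "adjoint_matrix (mat 1 :: complex^'n^'n) = mat 1"
  by (auto simp: adjoint_matrix_def vec_eq_iff mat_def)

lemma adjoint_mult: "adjoint_matrix (M ** N) = adjoint_matrix N ** adjoint_matrix M"
  by (simp add: adjoint_matrix_def vec_eq_iff matrix_matrix_mult_def mult.commute)

lemma inner_mult_complex: "x \<bullet> (a * y) = (cnj a * x) \<bullet> (y :: complex)"
  by (simp add: inner_complex_def algebra_simps)

lemma inner_matrix_adjoint: "x \<bullet> (M *v y) = (adjoint_matrix M *v x) \<bullet> y"
  for M :: "complex^'n^'m"
proof -
  have "x \<bullet> (M *v y) = (\<Sum>i\<in>UNIV. \<Sum>j\<in>UNIV. (cnj (M$i$j) * x$i) \<bullet> y$j)"
    by (simp add: inner_vec_def matrix_vector_mult_def inner_sum_right inner_mult_complex)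
  also have "\<dots> = (\<Sum>j\<in>UNIV. \<Sum>i\<in>UNIV. (cnj (M$i$j) * x$i) \<bullet> y$j)"
    by (rule sum.swap)
  also have "\<dots> = (adjoint_matrix M *v x) \<bullet> y"
    by (simp add: inner_vec_def matrix_vector_mult_def inner_sum_left adjoint_matrix_def)
  finally show ?thesis .
qed

text \<open>In particular \<open>adjoint_matrix X ** X\<close> has trace \<open>X \<bullet> X\<close>, which vanishes only for \<open>X = 0\<close>.\<close>

lemma Re_trace_adjoint_mult: "Re (trace (adjoint_matrix Y ** Z)) = Y \<bullet> Z"
  for Y Z :: "complex^'n^'n"
proof -
  have "Y \<bullet> Z = (\<Sum>i\<in>UNIV. \<Sum>j\<in>UNIV. Re (cnj (Y$i$j) * Z$i$j))"
    by (simp add: inner_vec_def inner_complex_def)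
  also have "\<dots> = (\<Sum>j\<in>UNIV. \<Sum>i\<in>UNIV. Re (cnj (Y$i$j) * Z$i$j))"
    by (rule sum.swap)
  also have "\<dots> = Re (trace (adjoint_matrix Y ** Z))"
    by (simp add: trace_def matrix_matrix_mult_def adjoint_matrix_def)
  finally show ?thesis by simp
qed

lemma hermitian_trace_real:
  assumes "hermitian M" shows "Im (trace M) = 0"
proof -
  have "Im (M$i$i) = 0" for i
  proof -
    have "adjoint_matrix M $ i $ i = M$i$i" using assms by (simp add: hermitian_def)
    then have "cnj (M$i$i) = M$i$i" by (simp add: adjoint_matrix_def)
    then show ?thesis by (simp add: complex_eq_iff)
  qed
  then show ?thesis by (simp add: trace_def)
qed

section \<open>Positive semidefinite matrices as quadratic forms\<close>

text \<open>A zero \<open>v\<close> of a nonnegative quadratic form is a minimum, so the form is stationary there.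
  Moving from \<open>v\<close> against \<open>w = M *v v\<close> changes the form by \<open>-2 t (w \<bullet> w)\<close> to first order, whence
  \<open>w = 0\<close>.\<close>

lemma semidefinite_kernel:
  fixes M :: "complex^'n^'n"
  assumes "hermitian M" and nonneg: "\<And>v. 0 \<le> v \<bullet> (M *v v)" and "v \<bullet> (M *v v) = 0"
  shows "M *v v = 0"
proof (rule ccontr)
  assume "M *v v \<noteq> 0"
  define w where "w = M *v v"
  define a where "a = w \<bullet> w"
  define b where "b = w \<bullet> (M *v w)"
  have a: "a > 0" using \<open>M *v v \<noteq> 0\<close> by (simp add: a_def w_def)
  have b: "b \<ge> 0" unfolding b_def by (rule nonneg)
  have q: "0 \<le> t\<^sup>2 * b - 2 * t * a" for t :: real
  proof -
    have *: "v \<bullet> (M *v w) = w \<bullet> w"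
      using assms(1) by (simp add: inner_matrix_adjoint hermitian_def w_def)
    have "0 \<le> (v - t *\<^sub>R w) \<bullet> (M *v (v - t *\<^sub>R w))" by (rule nonneg)
    also have "\<dots> = t\<^sup>2 * b - 2 * t * a"
      using assms(3) *
      by (simp add: matvec.diff_right matvec.scaleR_right inner_diff_left inner_diff_right
          flip: w_def) (simp add: a_def b_def power2_eq_square algebra_simps)
    finally show ?thesis .
  qed
  \<comment> \<open>A step so short that the linear term outweighs the quadratic one; \<open>b\<close> itself may be 0.\<close>
  define t where "t = a / (b + 1)"
  have t: "t > 0" "t * b < a"
    using a b by (auto simp: t_def field_simps)
  have "0 \<le> t * (t * b - 2 * a)"
    using q[of t] by (simp add: power2_eq_square algebra_simps)
  then show False using t a by (simp add: zero_le_mult_iff)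
qed

text \<open>As \<open>\<bullet>\<close> sees only real parts, the imaginary part of \<open>c\<close> is extracted by pairing \<open>v\<close> with
  \<open>\<i> *s v\<close>.\<close>

lemma hermitian_eigenvalue_real:
  assumes "hermitian M" "v \<noteq> 0" "M *v v = c *s v"
  shows "Im c = 0" and "v \<bullet> (M *v v) = Re c * (v \<bullet> v)"
proof -
  have sc: "v \<bullet> (z *s v) = Re z * (v \<bullet> v)" for z
    by (simp add: inner_vec_def inner_complex_def sum_distrib_left algebra_simps)
  show "v \<bullet> (M *v v) = Re c * (v \<bullet> v)" by (simp add: assms(3) sc)
  have "v \<bullet> (M *v (\<i> *s v)) = (M *v v) \<bullet> (\<i> *s v)"
    using assms(1) by (simp add: inner_matrix_adjoint hermitian_def)
  moreover have "M *v (\<i> *s v) = (\<i> * c) *s v"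
    by (metis assms(3) vector_scalar_commute vector_smult_assoc)
  moreover have "(c *s v) \<bullet> (\<i> *s v) = Im c * (v \<bullet> v)"
    by (simp add: inner_vec_def inner_complex_def sum_distrib_left algebra_simps)
  ultimately have "Im c * (v \<bullet> v) = 0" by (simp add: sc assms(3))
  then show "Im c = 0" using assms(2) by simp
qed

text \<open>The substance is that nonnegative eigenvalues imply a nonnegative form. Let \<open>\<mu>\<close> be the minimum
  of the form on the unit sphere, attained at \<open>u\<close>. The form of \<open>M - \<mu>\<close> is nonnegative and
  vanishes at \<open>u\<close>, so \<open>u\<close> is an eigenvector for \<open>\<mu>\<close> by \<open>semidefinite_kernel\<close>, and \<open>\<mu> \<ge> 0\<close>.\<close>

lemma psd_iff_quadratic_form:
  fixes M :: "complex^'n^'n"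
  shows "psd M \<longleftrightarrow> hermitian M \<and> (\<forall>v. 0 \<le> v \<bullet> (M *v v))"
proof (intro iffI conjI allI)
  assume psd: "psd M"
  then show herm: "hermitian M" by (simp add: psd_def)
  have cont: "continuous_on S (\<lambda>v. v \<bullet> (M *v v))" for S
    by (intro continuous_intros bounded_linear.continuous_on[OF matvec.bounded_linear_right])
  have "sphere 0 1 \<noteq> ({} :: (complex^'n) set)" by simp
  then obtain u where u: "u \<in> sphere 0 1" and
    umin: "\<And>v. v \<in> sphere 0 1 \<Longrightarrow> u \<bullet> (M *v u) \<le> v \<bullet> (M *v v)"
    using continuous_attains_inf[OF compact_sphere _ cont] by metis
  define \<mu> where "\<mu> = u \<bullet> (M *v u)"
  have uu: "u \<bullet> u = 1" using u by (simp add: dot_square_norm)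
  have lower: "\<mu> * (v \<bullet> v) \<le> v \<bullet> (M *v v)" for v
  proof (cases "v = 0")
    case False
    have "\<mu> \<le> sgn v \<bullet> (M *v sgn v)"
      unfolding \<mu>_def by (rule umin) (use False in \<open>simp add: norm_sgn\<close>)
    also have "\<dots> = (v \<bullet> (M *v v)) / (v \<bullet> v)"
      by (simp add: sgn_div_norm matvec.scaleR_right dot_square_norm power2_eq_square divide_simps)
    finally show ?thesis using False by (simp add: field_simps)
  qed simp
  define N where "N = M - \<mu> *\<^sub>R mat 1"
  have N: "N *v v = M *v v - \<mu> *\<^sub>R v" for v
    by (simp add: N_def matvec.diff_left matvec.scaleR_left)
  have "N *v u = 0"
  proof (rule semidefinite_kernel)
    show "hermitian N"
      using herm by (simp add: N_def hermitian_def linear_diff[OF linear_adjoint_matrix] linear_scale[OF linear_adjoint_matrix])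
  qed (use lower uu in \<open>auto simp: N inner_diff_right \<mu>_def\<close>)
  then have "M *v u = complex_of_real \<mu> *s u"
    unfolding N by (simp add: vec_eq_iff) (simp add: scaleR_conv_of_real)
  moreover have "u \<noteq> 0" using uu by auto
  ultimately have "eigenvalue M (complex_of_real \<mu>)" unfolding eigenvalue_def by blast
  then have "0 \<le> \<mu>" using psd by (auto simp: psd_def less_eq_complex_def)
  then show "0 \<le> v \<bullet> (M *v v)" for v
    using lower[of v] by (meson inner_ge_zero mult_nonneg_nonneg order_trans)
next
  assume *: "hermitian M \<and> (\<forall>v. 0 \<le> v \<bullet> (M *v v))"
  show "psd M"
    unfolding psd_def
  proof (intro conjI allI impI)
    fix c assume "eigenvalue M c"
    then obtain v where v: "v \<noteq> 0" "M *v v = c *s v" by (auto simp: eigenvalue_def)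
    have "0 \<le> Re c * (v \<bullet> v)"
      using * hermitian_eigenvalue_real(2)[OF _ v] by metis
    moreover have "0 < v \<bullet> v" using v by simp
    ultimately have "0 \<le> Re c" by (metis mult_neg_pos not_less)
    then show "0 \<le> c"
      using * hermitian_eigenvalue_real(1)[OF _ v] by (simp add: less_eq_complex_def)
  qed (use * in auto)
qed

lemma psd_congruence:
  fixes A C :: "complex^'n^'n"
  assumes "psd A"
  shows "psd (adjoint_matrix C ** A ** C)"
  unfolding psd_iff_quadratic_form
proof (intro conjI allI)
  show "hermitian (adjoint_matrix C ** A ** C)"
    using assms by (simp add: psd_def hermitian_def adjoint_mult matrix_mul_assoc)
  fix v
  have "v \<bullet> ((adjoint_matrix C ** A ** C) *v v) = (C *v v) \<bullet> (A *v (C *v v))"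
    by (simp add: inner_matrix_adjoint[of v "adjoint_matrix C"]
        flip: matrix_vector_mul_assoc)
  then show "0 \<le> v \<bullet> ((adjoint_matrix C ** A ** C) *v v)"
    using assms by (simp add: psd_iff_quadratic_form)
qed

lemma psd_scaleR:
  fixes A :: "complex^'n^'n"
  assumes "psd A" "0 \<le> r"
  shows "psd (r *\<^sub>R A)"
  using assms
  by (simp add: psd_iff_quadratic_form hermitian_def linear_scale[OF linear_adjoint_matrix]
      matvec.scaleR_left)

lemma psd_add:
  fixes A B :: "complex^'n^'n"
  assumes "psd A" "psd B"
  shows "psd (A + B)"
  using assms
  by (simp add: psd_iff_quadratic_form hermitian_def linear_add[OF linear_adjoint_matrix]
      matvec.add_left inner_add_right)

lemma psd_one: "psd (mat 1)"
  by (simp add: psd_iff_quadratic_form hermitian_def)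

lemma matrix_vector_mult_axis: "(M *v axis j 1) $ i = M $ i $ j"
  for M :: "complex^'n^'m"
  by (simp add: matrix_vector_mult_def axis_def if_distrib cong: if_cong)

lemma Re_trace_quadratic_form:
  fixes M :: "complex^'n^'n"
  shows "Re (trace M) = (\<Sum>i\<in>UNIV. axis i 1 \<bullet> (M *v axis i 1))"
  by (simp add: trace_def matrix_vector_mult_axis inner_axis' inner_complex_def)

lemma psd_trace_nonneg:
  assumes "psd M"
  shows "0 \<le> Re (trace M)"
  using assms unfolding Re_trace_quadratic_form psd_iff_quadratic_form
  by (intro sum_nonneg) auto

text \<open>The trace is the sum of the values of the form at the basis vectors. If it is not positive, all of
  these values are 0, so \<open>semidefinite_kernel\<close> kills every column.\<close>

lemma psd_trace_le_0_imp_0: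
  assumes "psd M" "Re (trace M) \<le> 0"
  shows "M = 0"
proof -
  have nonneg: "0 \<le> v \<bullet> (M *v v)" for v
    using assms(1) by (simp add: psd_iff_quadratic_form)
  have "(\<Sum>i\<in>UNIV. axis i 1 \<bullet> (M *v axis i 1)) = 0"
    using assms(2) psd_trace_nonneg[OF assms(1)] unfolding Re_trace_quadratic_form by linarith
  then have "axis i 1 \<bullet> (M *v axis i 1) = 0" for i
    using nonneg by (simp add: sum_nonneg_eq_0_iff)
  then have "M *v axis i 1 = 0" for i
    using assms(1) nonneg by (intro semidefinite_kernel) (auto simp: psd_def)
  then show ?thesis
    by (metis matrix_vector_mult_axis vec_eq_iff zero_index)
qed

lemma psd_trace_pos:
  assumes "psd M" "M \<noteq> 0"
  shows "0 < Re (trace M)"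
  using assms psd_trace_le_0_imp_0 by force

lemma closed_psd: "closed {M :: complex^'n^'n. psd M}"
proof -
  have "closed {M :: complex^'n^'n. adjoint_matrix M = M}"
    by (intro closed_Collect_eq continuous_intros
        bounded_linear.continuous_on[OF linear_adjoint_matrix[unfolded linear_conv_bounded_linear]])
  moreover have "closed {M :: complex^'n^'n. \<forall>v. 0 \<le> v \<bullet> (M *v v)}"
    by (intro closed_Collect_all closed_Collect_le continuous_intros
        bounded_linear.continuous_on[OF matvec.bounded_linear_left])
  ultimately show ?thesis
    unfolding psd_iff_quadratic_form hermitian_def by (rule closed_Collect_conj)
qed

section \<open>Sums of words: recursion, symmetries and convolution\<close>

lemma word_sum_0: "word_sum 0 k A B = (if k = 0 then mat 1 else 0)"
proof -
  have "{w. length w = 0 \<and> count_list w True = k} = (if k = 0 then {[]} else {})" by auto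
  then show ?thesis by (simp add: word_sum_def)
qed

text \<open>Words are sorted by their first letter.\<close>

lemma word_sum_Suc:
  "word_sum (Suc m) k A B =
    A ** word_sum m k A B + (if k = 0 then 0 else B ** word_sum m (k - 1) A B)"
proof -
  let ?W = "\<lambda>m k. {w. length w = m \<and> count_list w True = k}"
  have split: "?W (Suc m) k = Cons False ` ?W m k \<union> (if k = 0 then {} else Cons True ` ?W m (k - 1))"
    by (auto simp: image_iff length_Suc_conv split: if_splits)
  have A: "(\<Sum>w\<in>Cons False ` ?W m k. word_prod A B w) = A ** word_sum m k A B"
    by (simp add: sum.reindex word_sum_def matmul.sum_right)
  have B: "(\<Sum>w\<in>Cons True ` ?W m l. word_prod A B w) = B ** word_sum m l A B" for l
    by (simp add: sum.reindex word_sum_def matmul.sum_right)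
  show ?thesis
  proof (cases "k = 0")
    case True
    then show ?thesis using A split by (simp add: word_sum_def)
  next
    case False
    have "word_sum (Suc m) k A B = (\<Sum>w\<in>Cons False ` ?W m k. word_prod A B w)
        + (\<Sum>w\<in>Cons True ` ?W m (k - 1). word_prod A B w)"
      unfolding word_sum_def split using False
      by (simp only: if_False) (intro sum.union_disjoint; auto simp: finite_words)
    then show ?thesis using A B False by simp
  qed
qed

lemma word_prod_scaleR:
  "word_prod (a *\<^sub>R A) (b *\<^sub>R B) w =
    (a ^ count_list w False * b ^ count_list w True) *\<^sub>R word_prod A B w"
  by (induction w) (auto simp: matmul.scaleR_left matmul.scaleR_right algebra_simps)

lemma count_list_bool: "count_list w False + count_list w True = length w"
  by (induction w) auto

lemma word_sum_scaleR:
  "word_sum m k (a *\<^sub>R A) (b *\<^sub>R B) = (a ^ (m - k) * b ^ k) *\<^sub>R word_sum m k A B"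
  unfolding word_sum_def scaleR_sum_right
proof (rule sum.cong)
  fix w :: "bool list" assume "w \<in> {w. length w = m \<and> count_list w True = k}"
  then have "count_list w False = m - k" "count_list w True = k"
    using count_list_bool[of w] by auto
  then show "word_prod (a *\<^sub>R A) (b *\<^sub>R B) w = (a ^ (m - k) * b ^ k) *\<^sub>R word_prod A B w"
    by (simp add: word_prod_scaleR)
qed simp

lemma word_prod_swap: "word_prod A B (map Not w) = word_prod B A w"
  by (induction w) auto

lemma word_sum_swap:
  assumes "k \<le> m"
  shows "word_sum m (m - k) B A = word_sum m k A B"
  unfolding word_sum_def
proof (rule sum.reindex_bij_witness[of _ "map Not" "map Not"])
  have *: "count_list (map Not w) True = count_list w False" for w by (induction w) auto
  show "map Not w \<in> {w. length w = m \<and> count_list w True = k}"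
    if "w \<in> {w. length w = m \<and> count_list w True = m - k}" for w
    using that count_list_bool[of w] assms by (auto simp: *)
  show "map Not w \<in> {w. length w = m \<and> count_list w True = m - k}"
    if "w \<in> {w. length w = m \<and> count_list w True = k}" for w
    using that count_list_bool[of w] assms by (auto simp: *)
qed (auto simp: word_prod_swap comp_def)

lemma word_prod_append: "word_prod A B (u @ v) = word_prod A B u ** word_prod A B v"
  by (induction u) (auto simp: matrix_mul_assoc)

lemma adjoint_word_prod:
  assumes "hermitian A" "hermitian B"
  shows "adjoint_matrix (word_prod A B w) = word_prod A B (rev w)"
  using assms by (induction w) (auto simp: adjoint_mult word_prod_append hermitian_def)

text \<open>The adjoint reverses words, and reversal permutes the words with given length and letter count.\<close>

lemma hermitian_word_sum:
  assumes "hermitian A" "hermitian B"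
  shows "hermitian (word_sum m k A B)"
  unfolding hermitian_def word_sum_def linear_sum[OF linear_adjoint_matrix] adjoint_word_prod[OF assms]
  by (rule sum.reindex_bij_witness[of _ rev rev]) auto

lemma continuous_on_word_prod:
  "continuous_on S (\<lambda>p. word_prod (fst p) (snd p) w)"
proof (induction w)
  case (Cons b w)
  then show ?case by (cases b) (auto intro!: continuous_intros matmul.continuous_on)
qed (simp add: continuous_on_const)

lemma continuous_on_word_sum:
  "continuous_on S (\<lambda>p. word_sum m k (fst p) (snd p))"
  unfolding word_sum_def by (intro continuous_on_sum continuous_on_word_prod)

text \<open>The recursion of \<open>word_sum\<close> in its first argument passes to convolutions with an arbitrary
  sequence \<open>T\<close>. It is used with \<open>T l = S\<^sub>b\<^sub>,\<^sub>l\<close> to split words at a given position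
  (\<open>word_sum_add\<close>), and with \<open>T l = H S\<^sub>b\<^sub>,\<^sub>l\<close> to mark the position at which a letter has been
  replaced by \<open>H\<close> (\<open>has_vector_derivative_word_sum\<close>).\<close>

lemma convolution_word_sum_Suc:
  "(\<Sum>j\<le>k. word_sum (Suc i) j A B ** T (k - j)) =
    A ** (\<Sum>j\<le>k. word_sum i j A B ** T (k - j)) +
    (if k = 0 then 0 else B ** (\<Sum>j\<le>k - 1. word_sum i j A B ** T (k - 1 - j)))"
proof (cases k)
  case 0
  then show ?thesis by (simp add: word_sum_Suc matrix_mul_assoc)
next
  case (Suc l)
  have "(\<Sum>j\<le>k. word_sum (Suc i) j A B ** T (k - j)) =
      A ** (\<Sum>j\<le>k. word_sum i j A B ** T (k - j)) +
      (\<Sum>j\<le>k. (if j = 0 then 0 else B ** word_sum i (j - 1) A B) ** T (k - j))"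
    by (simp add: word_sum_Suc matmul.add_left sum.distrib matmul.sum_right matrix_mul_assoc)
  also have "(\<Sum>j\<le>k. (if j = 0 then 0 else B ** word_sum i (j - 1) A B) ** T (k - j)) =
      B ** (\<Sum>j\<le>l. word_sum i j A B ** T (l - j))"
    unfolding Suc sum.atMost_Suc_shift
    by (simp add: matmul.zero_left matmul.sum_right matrix_mul_assoc)
  finally show ?thesis by (simp add: Suc)
qed

lemma convolution_word_sum_0:
  "(\<Sum>j\<le>k. word_sum 0 j A B ** T (k - j)) = T k"
proof -
  have "(\<Sum>j\<le>k. word_sum 0 j A B ** T (k - j)) = (\<Sum>j\<le>k. if j = 0 then T k else 0)"
    by (intro sum.cong) (auto simp: word_sum_0 matmul.zero_left)
  then show ?thesis by simp
qed

lemma word_sum_add: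
  "word_sum (a + b) k A B = (\<Sum>j\<le>k. word_sum a j A B ** word_sum b (k - j) A B)"
proof (induction a arbitrary: k)
  case 0
  show ?case by (simp add: convolution_word_sum_0[where T = "\<lambda>l. word_sum b l A B"])
next
  case (Suc a)
  show ?case
    unfolding add_Suc convolution_word_sum_Suc[where T = "\<lambda>l. word_sum b l A B"]
    by (simp only: word_sum_Suc[of "a + b"] Suc.IH)
qed

section \<open>Derivative of word sums\<close>

text \<open>The product rule replaces one occurrence of the letter \<open>P\<close> by \<open>H\<close>. Such an occurrence at position
  \<open>i\<close> leaves a word of length \<open>i\<close> before it and one of length \<open>m - 1 - i\<close> after it, which share the
  \<open>k\<close> letters \<open>B\<close> between them.\<close>

lemma has_vector_derivative_word_sum:
  fixes P :: "real \<Rightarrow> complex^'n^'n"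
  assumes P: "(P has_vector_derivative H) (at t)"
  shows "((\<lambda>s. word_sum m k (P s) B) has_vector_derivative
    (\<Sum>i<m. \<Sum>j\<le>k. word_sum i j (P t) B ** (H ** word_sum (m - 1 - i) (k - j) (P t) B))) (at t)"
proof (induction m arbitrary: k)
  case 0
  show ?case by (simp add: word_sum_0)
next
  case (Suc m)
  define S where "S i j = word_sum i j (P t) B" for i j
  define D where "D l = (\<Sum>i<m. \<Sum>j\<le>l. S i j ** (H ** S (m - 1 - i) (l - j)))" for l
  have IH: "((\<lambda>s. word_sum m l (P s) B) has_vector_derivative D l) (at t)" for l
    using Suc.IH[of l] by (simp add: D_def S_def)
  have "((\<lambda>s. P s ** word_sum m k (P s) B + (if k = 0 then 0 else B ** word_sum m (k - 1) (P s) B))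
      has_vector_derivative (P t ** D k + H ** S m k) + (if k = 0 then 0 else B ** D (k - 1))) (at t)"
    unfolding S_def using IH
    by (auto intro!: has_vector_derivative_add matmul.has_vector_derivative P
        bounded_linear.has_vector_derivative[OF matmul.bounded_linear_right])
  moreover have "(\<Sum>i<Suc m. \<Sum>j\<le>k. S i j ** (H ** S (Suc m - 1 - i) (k - j)))
      = (P t ** D k + H ** S m k) + (if k = 0 then 0 else B ** D (k - 1))"
  proof -
    have "(\<Sum>j\<le>k. S 0 j ** (H ** S m (k - j))) = H ** S m k"
      unfolding S_def by (rule convolution_word_sum_0)
    moreover have "(\<Sum>i<m. \<Sum>j\<le>k. S (Suc i) j ** (H ** S (m - 1 - i) (k - j))) =
        P t ** D k + (if k = 0 then 0 else B ** D (k - 1))"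
      unfolding S_def convolution_word_sum_Suc[where T = "\<lambda>l. H ** word_sum _ l _ _"]
      by (simp add: sum.distrib D_def S_def matmul.sum_right)
    ultimately show ?thesis by (simp add: sum.lessThan_Suc_shift add_ac del: sum.lessThan_Suc)
  qed
  ultimately show ?case by (simp add: word_sum_Suc S_def)
qed

text \<open>Under the trace, each marked word can be rotated so that \<open>H\<close> comes last. The two remaining pieces
  then recombine, by \<open>word_sum_add\<close>, to the same sum for each of the \<open>m\<close> positions.\<close>

lemma has_vector_derivative_trace_word_sum:
  fixes P :: "real \<Rightarrow> complex^'n^'n"
  assumes P: "(P has_vector_derivative H) (at t)"
  shows "((\<lambda>s. trace (word_sum m k (P s) B)) has_vector_derivative
    of_nat m * trace (word_sum (m - 1) k (P t) B ** H)) (at t)"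
proof -
  define S where "S i j = word_sum i j (P t) B" for i j
  have "trace (\<Sum>i<m. \<Sum>j\<le>k. S i j ** (H ** S (m - 1 - i) (k - j))) =
      (\<Sum>i<m. trace (\<Sum>j\<le>k. S (m - 1 - i) (k - j) ** S i j ** H))"
    unfolding linear_sum[OF linear_trace]
    by (intro sum.cong refl, subst trace_mul_sym)
       (metis matrix_mul_assoc trace_mul_sym)
  also have "\<dots> = (\<Sum>i<m. trace (S (m - 1) k ** H))"
  proof (intro sum.cong refl)
    fix i assume "i \<in> {..<m}"
    then have "S (m - 1) k = (\<Sum>j\<le>k. S (m - 1 - i) j ** S i (k - j))"
      unfolding S_def using word_sum_add[of "m - 1 - i" i k] by simp
    also have "\<dots> = (\<Sum>j\<le>k. S (m - 1 - i) (k - j) ** S i j)"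
      by (rule sum.reindex_bij_witness[of _ "\<lambda>j. k - j" "\<lambda>j. k - j"]) auto
    finally show "trace (\<Sum>j\<le>k. S (m - 1 - i) (k - j) ** S i j ** H) = trace (S (m - 1) k ** H)"
      by (simp add: matmul.sum_left)
  qed
  also have "\<dots> = of_nat m * trace (S (m - 1) k ** H)" by simp
  finally show ?thesis
    using bounded_linear.has_vector_derivative[OF linear_trace[unfolded linear_conv_bounded_linear] has_vector_derivative_word_sum[OF P, of m k B]]
    by (simp add: S_def)
qed

section \<open>A minimising pair and its first-order condition\<close>

text \<open>Semidefinite matrices of norm 1 form a compact set on which the trace is positive, so the
  quotient of \<open>Tr S\<^sub>m\<^sub>,\<^sub>k\<close> by the traces of \<open>P\<close> and \<open>Q\<close>, raised to their degrees in it, has a minimum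
  there. The quotient is invariant under scaling; so the minimiser may be rescaled to trace 1, and
  the bound holds for semidefinite matrices of every norm.\<close>

lemma trace_word_sum_minimizer:
  assumes "0 < k" "k < m"
  obtains A B :: "complex^'n^'n" where "psd A" "psd B" "trace A = 1" "trace B = 1"
    "\<And>P Q :: complex^'n^'n. psd P \<Longrightarrow> psd Q \<Longrightarrow>
       Re (trace (word_sum m k A B)) * Re (trace P) ^ (m - k) * Re (trace Q) ^ k
         \<le> Re (trace (word_sum m k P Q))"
proof -
  define K where "K = {M :: complex^'n^'n. psd M} \<inter> sphere 0 1"
  define r where "r A B = Re (trace (word_sum m k A B)) /
    (Re (trace A) ^ (m - k) * Re (trace B) ^ k)" for A B :: "complex^'n^'n"
  have scale: "r (a *\<^sub>R A) (b *\<^sub>R B) = r A B" if "a \<noteq> 0" "b \<noteq> 0" for a b A B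
    using that
    by (simp add: r_def word_sum_scaleR linear_scale[OF linear_trace] power_mult_distrib)
  have sgn: "sgn P \<in> K" if "psd P" "P \<noteq> 0" for P
    using that by (simp add: K_def norm_sgn sgn_div_norm psd_scaleR)
  have pos: "0 < Re (trace M)" if "M \<in> K" for M
    using that by (intro psd_trace_pos) (auto simp: K_def)
  have "compact K"
    unfolding K_def by (intro closed_Int_compact closed_psd compact_sphere)
  then have "compact (K \<times> K)" by (intro compact_Times)
  moreover have "K \<times> K \<noteq> {}"
  proof -
    have "(mat 1 :: complex^'n^'n) $ i $ i \<noteq> 0" for i by (simp add: mat_def)
    then have "(mat 1 :: complex^'n^'n) \<noteq> 0" by (metis zero_index)
    then show ?thesis using sgn[OF psd_one] by auto
  qed
  moreover have "continuous_on (K \<times> K) (\<lambda>p. r (fst p) (snd p))"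
    unfolding r_def
    by (intro continuous_intros continuous_on_word_sum
        bounded_linear.continuous_on[OF linear_trace[unfolded linear_conv_bounded_linear]])
       (auto dest!: pos)
  ultimately obtain p where p: "p \<in> K \<times> K"
    and p_min: "\<And>q. q \<in> K \<times> K \<Longrightarrow> r (fst p) (snd p) \<le> r (fst q) (snd q)"
    using continuous_attains_inf[of "K \<times> K" "\<lambda>p. r (fst p) (snd p)"] by metis
  define norm1 where "norm1 M = (1 / Re (trace M)) *\<^sub>R M" for M :: "complex^'n^'n"
  have norm1: "psd (norm1 M)" "trace (norm1 M) = 1" if "M \<in> K" for M
  proof -
    have "psd M" using that by (simp add: K_def)
    then show "psd (norm1 M)"
      unfolding norm1_def using pos[OF that] by (intro psd_scaleR) auto
    have "Im (trace M) = 0"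
      using \<open>psd M\<close> by (intro hermitian_trace_real) (simp add: psd_def)
    then show "trace (norm1 M) = 1"
      using pos[OF that] by (simp add: norm1_def linear_scale[OF linear_trace] complex_eq_iff)
  qed
  define A where "A = norm1 (fst p)"
  define B where "B = norm1 (snd p)"
  have AB: "psd A" "psd B" "trace A = 1" "trace B = 1"
    using p norm1 by (auto simp: A_def B_def)
  have "r A B = r (fst p) (snd p)"
    unfolding A_def B_def norm1_def using p pos by (intro scale) fastforce+
  moreover have "r A B = Re (trace (word_sum m k A B))"
    by (simp add: r_def AB)
  ultimately have c: "Re (trace (word_sum m k A B)) = r (fst p) (snd p)" by simp
  show thesis
  proof (rule that[OF AB])
    fix P Q :: "complex^'n^'n" assume PQ: "psd P" "psd Q"
    show "Re (trace (word_sum m k A B)) * Re (trace P) ^ (m - k) * Re (trace Q) ^ k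
         \<le> Re (trace (word_sum m k P Q))"
    proof (cases "P = 0 \<or> Q = 0")
      case True
      then have "word_sum m k P Q = 0"
        using assms word_sum_scaleR[of m k 0 P 1 Q] word_sum_scaleR[of m k 1 P 0 Q]
        by (auto simp: power_0_left)
      then show ?thesis using True assms by (auto simp: linear_0[OF linear_trace] power_0_left)
    next
      case False
      then have "r (fst p) (snd p) \<le> r (sgn P) (sgn Q)"
        using p_min[of "(sgn P, sgn Q)"] sgn PQ by simp
      also have "\<dots> = r P Q"
        using False by (simp add: sgn_div_norm scale)
      finally show ?thesis
        using psd_trace_pos[OF PQ(1)] psd_trace_pos[OF PQ(2)] False
        by (simp add: c r_def pos_le_divide_eq mult.assoc)
    qed
  qed
qed

text \<open>With \<open>G = m S\<^sub>m\<^sub>-\<^sub>1\<^sub>,\<^sub>k - c d\<close>, stationarity along \<open>(1 + t X)\<^sup>* A (1 + t X)\<close>, whose velocity at 0 is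
  \<open>H = A X + X\<^sup>* A\<close>, says that \<open>G H\<close> has trace with real part 0. The choice \<open>X = A G\<close>, for which
  \<open>X\<^sup>* = G A\<close>, makes both terms of that trace equal to \<open>X \<bullet> X\<close>, so \<open>A G = 0\<close>.
  The minimality hypothesis is homogeneous: it bounds \<open>word_sum m k P B\<close>, of degree \<open>m - k\<close> in
  \<open>P\<close>, by the power \<open>d = m - k\<close> of the trace in the application. So the curve
  may leave the matrices of trace 1, and the term \<open>c d\<close> in \<open>G\<close> is the derivative of \<open>c x\<^sup>d\<close> at
  \<open>x = 1\<close>, in place of a Lagrange multiplier.\<close>

lemma first_order_condition:
  fixes A B :: "complex^'n^'n"
  assumes psd: "psd A" "psd B" and trace: "trace A = 1"
    and value_A: "Re (trace (word_sum m k A B)) = c"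
    and minimal: "\<And>P. psd P \<Longrightarrow> c * Re (trace P) ^ d \<le> Re (trace (word_sum m k P B))"
  shows "real m *\<^sub>R (A ** word_sum (m - 1) k A B) = (c * real d) *\<^sub>R A"
proof -
  define S where "S = word_sum (m - 1) k A B"
  define G where "G = real m *\<^sub>R S - (c * real d) *\<^sub>R mat 1"
  define X where "X = A ** G"
  define H where "H = A ** X + adjoint_matrix X ** A"
  have "hermitian A" "hermitian B" using psd by (auto simp: psd_def)
  then have "adjoint_matrix A = A" "adjoint_matrix G = G"
    using hermitian_word_sum[of A B "m - 1" k]
    by (auto simp: G_def S_def hermitian_def linear_diff[OF linear_adjoint_matrix]
        linear_scale[OF linear_adjoint_matrix])
  then have adjX: "adjoint_matrix X = G ** A" by (simp add: X_def adjoint_mult)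

  define C where "C t = mat 1 + t *\<^sub>R X" for t :: real
  define P where "P t = adjoint_matrix (C t) ** A ** C t" for t
  have P0: "P 0 = A" by (simp add: P_def C_def)
  have C': "(C has_vector_derivative X) (at 0)"
    unfolding C_def by (auto intro!: derivative_eq_intros)
  have "(P has_vector_derivative adjoint_matrix (C 0) ** A ** X
      + adjoint_matrix X ** A ** C 0) (at 0)"
    unfolding P_def
    by (intro matmul.has_vector_derivative C'
        bounded_linear.has_vector_derivative[OF matmul.bounded_linear_left]
        bounded_linear.has_vector_derivative
          [OF linear_adjoint_matrix[unfolded linear_conv_bounded_linear]])
  then have P': "(P has_vector_derivative H) (at 0)"
    by (simp add: H_def C_def)

  have Re': "((\<lambda>t. Re (f t)) has_real_derivative Re f') (at t)"
    if "(f has_vector_derivative f') (at t)" for f f' t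
    using bounded_linear.has_vector_derivative[OF bounded_linear_Re that]
    by (simp add: has_real_derivative_iff_has_vector_derivative)
  define g where "g t = Re (trace (word_sum m k (P t) B)) - c * Re (trace (P t)) ^ d" for t
  have trP': "((\<lambda>t. Re (trace (P t))) has_real_derivative Re (trace H)) (at 0)"
    by (intro Re' P' bounded_linear.has_vector_derivative
        [OF linear_trace[unfolded linear_conv_bounded_linear]])
  have trS': "((\<lambda>t. Re (trace (word_sum m k (P t) B))) has_real_derivative
      Re (of_nat m * trace (S ** H))) (at 0)"
    using Re'[OF has_vector_derivative_trace_word_sum[OF P', of m k B]] by (simp add: P0 S_def)
  have "(g has_real_derivative Re (of_nat m * trace (S ** H)) - c * (real d * Re (trace H))) (at 0)"
    unfolding g_def
    by (rule DERIV_cong[OF DERIV_diff[OF trS' DERIV_cmult[OF DERIV_power[OF trP']]]])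
       (simp add: P0 trace)
  moreover have "g 0 \<le> g t" for t
  proof -
    have "psd (P t)" unfolding P_def by (intro psd_congruence psd)
    then have "0 \<le> g t" using minimal by (simp add: g_def)
    then show ?thesis by (simp add: g_def P0 trace value_A)
  qed
  ultimately have "Re (of_nat m * trace (S ** H)) - c * (real d * Re (trace H)) = 0"
    by (intro DERIV_local_min[of g _ 0 1]) auto
  then have "Re (trace (G ** H)) = 0"
    by (simp add: G_def matmul.diff_left matmul.scaleR_left linear_diff[OF linear_trace]
        linear_scale[OF linear_trace])
  moreover have "trace (G ** (A ** X)) = trace (adjoint_matrix X ** X)"
    by (simp add: adjX matrix_mul_assoc)
  moreover have "trace (G ** (adjoint_matrix X ** A)) = trace (adjoint_matrix X ** X)"
    by (subst trace_mul_sym) (simp add: X_def matrix_mul_assoc)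
  ultimately have "X \<bullet> X = 0"
    by (simp add: H_def matmul.add_right linear_add[OF linear_trace] Re_trace_adjoint_mult)
  then show ?thesis
    by (simp add: X_def G_def S_def matmul.diff_right matmul.scaleR_right)
qed

section \<open>The equivalence\<close>

theorem theorem1p10:
  fixes m k :: nat
  assumes "0 < k" and "k < m"
  shows "(\<forall>A B :: complex^'n^'n. psd A \<and> psd B \<longrightarrow> 0 \<le> trace (word_sum m k A B))
    \<longleftrightarrow> (\<forall>A B :: complex^'n^'n. psd A \<and> psd B \<and> word_sum m k A B \<noteq> 0
          \<longrightarrow> (\<exists>c. eigenvalue (word_sum m k A B) c \<and> 0 < c))"
    (is "?trace_nonneg \<longleftrightarrow> ?positive_eigenvalue")
proof
  assume i: ?trace_nonneg
  show ?positive_eigenvalue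
  proof (intro allI impI, rule ccontr)
    fix A B :: "complex^'n^'n"
    assume AB: "psd A \<and> psd B \<and> word_sum m k A B \<noteq> 0"
    define S where "S = word_sum m k A B"
    assume "\<not> (\<exists>c. eigenvalue (word_sum m k A B) c \<and> 0 < c)"
    then have no_pos: "\<not> 0 < c" if "eigenvalue S c" for c using that by (auto simp: S_def)
    have herm: "hermitian S"
      unfolding S_def using AB by (intro hermitian_word_sum) (auto simp: psd_def)
    have "psd (- S)"
      unfolding psd_def
    proof (intro conjI allI impI)
      show "hermitian (- S)"
        using herm by (simp add: hermitian_def linear_neg[OF linear_adjoint_matrix])
      fix c assume "eigenvalue (- S) c"
      then obtain v where v: "v \<noteq> 0" "(- S) *v v = c *s v" by (auto simp: eigenvalue_def)
      then have Sv: "S *v v = (- c) *s v"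
        by (simp add: matvec.minus_left) (metis minus_equation_iff vector_sneg_minus1 vector_smult_assoc mult_minus1)
      then have "\<not> 0 < - c" using v no_pos unfolding eigenvalue_def by blast
      moreover have "Im c = 0"
        using hermitian_eigenvalue_real(1)[OF herm v(1) Sv] by simp
      ultimately show "0 \<le> c"
        by (auto simp: less_complex_def less_eq_complex_def)
    qed
    moreover have "Re (trace (- S)) \<le> 0"
      using i AB by (auto simp: S_def linear_neg[OF linear_trace] less_eq_complex_def)
    ultimately have "- S = 0" by (rule psd_trace_le_0_imp_0)
    then show False using AB by (simp add: S_def)
  qed
next
  assume ii: ?positive_eigenvalue
  obtain A B :: "complex^'n^'n" where psd: "psd A" "psd B" and tr: "trace A = 1" "trace B = 1"
    and minimal: "\<And>P Q :: complex^'n^'n. psd P \<Longrightarrow> psd Q \<Longrightarrow>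
       Re (trace (word_sum m k A B)) * Re (trace P) ^ (m - k) * Re (trace Q) ^ k
         \<le> Re (trace (word_sum m k P Q))"
    by (rule trace_word_sum_minimizer[OF assms]) blast
  define S where "S = word_sum m k A B"
  define c where "c = Re (trace S)"
  have "0 \<le> c"
  proof (rule ccontr)
    assume neg: "\<not> 0 \<le> c"
    \<comment> \<open>As \<open>trace B = 1\<close>, the power of \<open>trace Q\<close> in the minimality bound is 1 when only \<open>P\<close> varies.\<close>
    have "real m *\<^sub>R (A ** word_sum (m - 1) k A B) = (c * real (m - k)) *\<^sub>R A"
    proof (rule first_order_condition)
      show "c * Re (trace P) ^ (m - k) \<le> Re (trace (word_sum m k P B))" if "psd P" for P
        using minimal[OF that psd(2)] tr by (simp add: c_def S_def)
    qed (use psd tr in \<open>auto simp: c_def S_def\<close>)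
    moreover have "real m *\<^sub>R (B ** word_sum (m - 1) (m - k) B A) = (c * real k) *\<^sub>R B"
    proof (rule first_order_condition)
      show "c * Re (trace Q) ^ k \<le> Re (trace (word_sum m (m - k) Q A))" if "psd Q" for Q
        using minimal[OF psd(1) that] tr assms by (simp add: c_def S_def word_sum_swap)
    qed (use psd tr assms in \<open>auto simp: c_def S_def word_sum_swap\<close>)
    moreover have "word_sum (m - 1) (m - k) B A = word_sum (m - 1) (k - 1) A B"
      using word_sum_swap[of "k - 1" "m - 1" B A] assms by simp
    moreover have "S = A ** word_sum (m - 1) k A B + B ** word_sum (m - 1) (k - 1) A B"
      using word_sum_Suc[of "m - 1" k A B] assms by (simp add: S_def)
    ultimately have "real m *\<^sub>R S = c *\<^sub>R (real (m - k) *\<^sub>R A + real k *\<^sub>R B)"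
      by (simp add: scaleR_add_right)
    then have "real m *\<^sub>R (- S) = (- c) *\<^sub>R (real (m - k) *\<^sub>R A + real k *\<^sub>R B)"
      by simp
    moreover have "psd ((- c) *\<^sub>R (real (m - k) *\<^sub>R A + real k *\<^sub>R B))"
      using neg psd by (intro psd_scaleR psd_add) auto
    ultimately have "psd (real m *\<^sub>R (- S))" by (simp only:)
    then have "psd ((1 / real m) *\<^sub>R (real m *\<^sub>R (- S)))"
      by (rule psd_scaleR) simp
    moreover have "(1 / real m) *\<^sub>R (real m *\<^sub>R (- S)) = - S" using assms by simp
    ultimately have "psd (- S)" by (simp only:)

    have "S \<noteq> 0" using neg by (auto simp: c_def linear_0[OF linear_trace])
    then obtain e v where e: "0 < e" and v: "v \<noteq> 0" "S *v v = e *s v"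
      using ii psd unfolding S_def eigenvalue_def by blast
    have "hermitian S"
      unfolding S_def using psd by (intro hermitian_word_sum) (auto simp: psd_def)
    then have "v \<bullet> (S *v v) = Re e * (v \<bullet> v)"
      using hermitian_eigenvalue_real(2) v by blast
    moreover have "0 < Re e * (v \<bullet> v)" using e v by (simp add: less_complex_def)
    moreover have "v \<bullet> (S *v v) \<le> 0"
      using \<open>psd (- S)\<close> by (simp add: psd_iff_quadratic_form matvec.minus_left)
    ultimately show False by simp
  qed
  show ?trace_nonneg
  proof (intro allI impI)
    fix P Q :: "complex^'n^'n" assume PQ: "psd P \<and> psd Q"
    have "0 \<le> c * Re (trace P) ^ (m - k) * Re (trace Q) ^ k"
      using \<open>0 \<le> c\<close> PQ by (simp add: psd_trace_nonneg)
    also have "\<dots> \<le> Re (trace (word_sum m k P Q))"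
      unfolding c_def S_def using PQ by (intro minimal) auto
    finally show "0 \<le> trace (word_sum m k P Q)"
      using PQ hermitian_trace_real[OF hermitian_word_sum[of P Q m k]]
      by (simp add: less_eq_complex_def psd_def)
  qed
qed

end
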